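(* Let $d$ be a strictly convex distance function on $\mathbb{R}^2$. There is a constant $C$, depending only on $d$, such that the following holds. Let $S\subset\mathbb{R}^2$ be a set of at least two points such that $d(p,q)$ is an integer for all $p,q\in S$, and such that $S$ has finite diameter $D=\sup_{p,q\in S}d(p,q)$. Then $|S|\le C D$.
   Context: A convex distance function on $\mathbb{R}^2$ is defined from a centrally symmetric (about the origin) compact convex body $K\subset\mathbb{R}^2$ (with nonempty interior): $d_K(p,q)$ is the smallest scale factor $s\ge 0$ such that the copy of $K$ scaled by $s$ and centered at $p$ contains $q$, i.e. $q\in p+sK$. Equivalently $d_K(p,q)=\|q-p\|_K$ for the norm with closed unit ball $K$. The distance function is strictly convex if $K$ is strictly convex, i.e. the boundary of $K$ contains no (nondegenerate) line segment. *)

theory Defs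
  imports "HOL-Analysis.Analysis"
begin

definition symmetric_convex_body :: "(real^2) set \<Rightarrow> bool" where
  "symmetric_convex_body K \<longleftrightarrow>
     compact K \<and> convex K \<and> interior K \<noteq> {} \<and> (\<forall>x\<in>K. - x \<in> K)"

definition strictly_convex_body :: "(real^2) set \<Rightarrow> bool" where
  "strictly_convex_body K \<longleftrightarrow>
     (\<forall>a b. a \<noteq> b \<longrightarrow> \<not> closed_segment a b \<subseteq> frontier K)"

(* The minimum exists for every symmetric convex body, see body_dist_smallest below. *)
definition body_dist :: "(real^2) set \<Rightarrow> real^2 \<Rightarrow> real^2 \<Rightarrow> real" where
  "body_dist K p q = (LEAST s. 0 \<le> s \<and> q \<in> (\<lambda>x. p + s *\<^sub>R x) ` K)"

definition strictly_convex_distance :: "(real^2 \<Rightarrow> real^2 \<Rightarrow> real) \<Rightarrow> bool" where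
  "strictly_convex_distance d \<longleftrightarrow>
     (\<exists>K. symmetric_convex_body K \<and> strictly_convex_body K \<and> d = body_dist K)"

lemma symmetric_convex_body_contains_ball:
  assumes "symmetric_convex_body K"
  obtains e where "e > 0" "cball 0 e \<subseteq> K"
proof -
  obtain c e where e: "e > 0" "cball c e \<subseteq> K"
    using assms by (force simp: symmetric_convex_body_def mem_interior_cball)
  have "x \<in> K" if "x \<in> cball 0 e" for x
  proof -
    have "c + x \<in> K" "c - x \<in> K"
      using e that by (auto simp: subset_iff dist_norm)
    then have "- (c - x) \<in> K"
      using assms unfolding symmetric_convex_body_def by blast
    with \<open>c + x \<in> K\<close> have "(1/2) *\<^sub>R (c + x) + (1/2) *\<^sub>R (- (c - x)) \<in> K"
      using assms by (intro convexD) (auto simp: symmetric_convex_body_def)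
    moreover have "(1/2) *\<^sub>R (c + x) + (1/2) *\<^sub>R (- (c - x)) = x"
      by (simp add: algebra_simps flip: scaleR_add_left)
    ultimately show ?thesis by simp
  qed
  with e that show ?thesis by blast
qed

lemma body_dist_smallest:
  assumes K: "symmetric_convex_body K"
  shows "0 \<le> body_dist K p q"
    and "q \<in> (\<lambda>x. p + body_dist K p q *\<^sub>R x) ` K"
    and "\<And>s. 0 \<le> s \<Longrightarrow> q \<in> (\<lambda>x. p + s *\<^sub>R x) ` K \<Longrightarrow> body_dist K p q \<le> s"
proof -
  let ?A = "{s. 0 \<le> s \<and> q \<in> (\<lambda>x. p + s *\<^sub>R x) ` K}"
  obtain e where e: "e > 0" "cball 0 e \<subseteq> K"
    using symmetric_convex_body_contains_ball[OF K] .
  define t where "t = norm (q - p) / e + 1"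
  have t: "t > 0" "norm (q - p) \<le> e * t"
    using e by (auto simp: t_def field_simps add_pos_nonneg)
  have "norm ((q - p) /\<^sub>R t) = norm (q - p) / t"
    using t by (simp add: divide_inverse mult.commute)
  also have "\<dots> \<le> e"
    using t by (simp add: pos_divide_le_eq)
  finally have "norm ((q - p) /\<^sub>R t) \<le> e" .
  then have "(q - p) /\<^sub>R t \<in> K"
    using e by (auto simp: subset_iff)
  then have "t \<in> ?A"
    using t by (auto intro: rev_image_eqI)
  have cK: "compact K" using K by (simp add: symmetric_convex_body_def)
  have "compact ({0..t} \<times> K)"
    using cK by (intro compact_Times) auto
  moreover have "closed ((\<lambda>z. p + fst z *\<^sub>R snd z) -` {q})"
    by (intro continuous_closed_vimage) (auto intro!: continuous_intros)
  ultimately have "compact (({0..t} \<times> K) \<inter> (\<lambda>z. p + fst z *\<^sub>R snd z) -` {q})"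
    by (rule compact_Int_closed)
  then have "compact (fst ` (({0..t} \<times> K) \<inter> (\<lambda>z. p + fst z *\<^sub>R snd z) -` {q}))"
    by (intro compact_continuous_image continuous_intros)
  also have "fst ` (({0..t} \<times> K) \<inter> (\<lambda>z. p + fst z *\<^sub>R snd z) -` {q}) = ?A \<inter> {..t}"
  proof (intro set_eqI iffI)
    fix s assume "s \<in> ?A \<inter> {..t}"
    then obtain x where "0 \<le> s" "s \<le> t" "x \<in> K" "q = p + s *\<^sub>R x" by blast
    then have "(s, x) \<in> ({0..t} \<times> K) \<inter> (\<lambda>z. p + fst z *\<^sub>R snd z) -` {q}" by simp
    then show "s \<in> fst ` (({0..t} \<times> K) \<inter> (\<lambda>z. p + fst z *\<^sub>R snd z) -` {q})"
      by (rule rev_image_eqI) simp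
  qed auto
  finally have "compact (?A \<inter> {..t})" .
  moreover have "?A \<inter> {..t} \<noteq> {}" using \<open>t \<in> ?A\<close> by blast
  ultimately have "\<exists>m\<in>?A \<inter> {..t}. \<forall>s\<in>?A \<inter> {..t}. m \<le> s"
    by (rule compact_attains_inf)
  then obtain m where m: "m \<in> ?A \<inter> {..t}" "\<forall>s\<in>?A \<inter> {..t}. m \<le> s" ..
  have least: "m \<le> s" if "s \<in> ?A" for s
  proof (cases "s \<le> t")
    case True
    then have "s \<in> ?A \<inter> {..t}" using that by simp
    with m(2) show ?thesis ..
  next
    case False
    with m(1) show ?thesis by simp
  qed
  have "body_dist K p q = m"
    unfolding body_dist_def
  proof (rule Least_equality)
    show "0 \<le> m \<and> q \<in> (\<lambda>x. p + m *\<^sub>R x) ` K" using m(1) by simp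
    show "m \<le> s" if "0 \<le> s \<and> q \<in> (\<lambda>x. p + s *\<^sub>R x) ` K" for s
      using least that by simp
  qed
  then have "body_dist K p q \<in> ?A" "\<And>s. s \<in> ?A \<Longrightarrow> body_dist K p q \<le> s"
    using m(1) least by simp_all
  then show "0 \<le> body_dist K p q"
    and "q \<in> (\<lambda>x. p + body_dist K p q *\<^sub>R x) ` K"
    and "\<And>s. 0 \<le> s \<Longrightarrow> q \<in> (\<lambda>x. p + s *\<^sub>R x) ` K \<Longrightarrow> body_dist K p q \<le> s"
    by simp_all
qed

end

theory Submission
  imports Defs
begin

text \<open>
  Let \<open>N\<close> be the norm with unit ball \<open>K\<close>, let \<open>n\<close> be the size of \<open>S\<close> and \<open>D\<close> its diameter.
  A collinear \<open>S\<close> has gaps of length at least \<open>1\<close> and thus at most \<open>2 D + 2\<close> points, so suppose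
  that \<open>S\<close> is not collinear.

  The first ingredient is an Erdos-Anning bound. Let \<open>p\<close>, \<open>q\<close>, \<open>r\<close> be a triangle of points of
  \<open>S\<close> with \<open>N (p - q) \<le> a\<close> and \<open>N (p - r) \<le> b\<close>. For \<open>x\<close> in \<open>S\<close>, the differences
  \<open>N (x - p) - N (x - q)\<close> and \<open>N (x - p) - N (x - r)\<close> are integers in \<open>[-a, a]\<close> and \<open>[-b, b]\<close>. The
  two differences, together with the cell of \<open>x\<close> in the arrangement of the three side lines,
  determine \<open>x\<close> (\<open>eq_if_same_signs_and_differences\<close>). Indeed, for two such points \<open>x\<close>, \<open>y\<close> in the
  same cell, a segment from \<open>x\<close> to one of the vertices meets the segment from \<open>y\<close> to another one.
  If \<open>x p\<close> and \<open>y q\<close> meet in \<open>z\<close>, then exchanging the ends at \<open>z\<close> gives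
  \<open>N (x - q) + N (y - p) \<le> N (x - p) + N (y - q)\<close>. The equal differences force equality here, so
  by strict convexity neither of the two exchanged paths bends at \<open>z\<close>. For \<open>x\<close> and \<open>y\<close> off the
  line \<open>p q\<close> this leaves only \<open>x = z = y\<close>.
  There are at most \<open>27\<close> sign patterns, hence \<open>n \<le> 27 (2 a + 1) (2 b + 1)\<close>.

  The second ingredient finds small triangles. For \<open>p\<close> in \<open>S\<close>, let \<open>\<rho> p\<close> be the least integer
  radius whose closed ball around \<open>p\<close> meets \<open>S\<close> in a non-collinear set. The points of \<open>S\<close> in the
  open ball lie on one line. If the smallest distance between two of them is \<open>a\<close>, there
  are \<open>O(\<rho> p / a)\<close> of them, and the closest pair forms a triangle with a further point of the
  closed ball, so that \<open>n = O(a \<rho> p)\<close>. The unknown \<open>a\<close> cancels in the product: \<open>n\<close> times the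
  number of points in the open ball is \<open>O((\<rho> p)\<^sup>2)\<close> (\<open>card_times_card_ball_le\<close>).

  Finally, \<open>S\<close> is covered by greedily chosen open balls with radii \<open>\<rho> p\<close> that become disjoint when
  shrunk by a constant factor. Comparing areas gives \<open>O(D\<^sup>2)\<close> for the sum of the squared radii.
  Adding the local estimates over this cover yields \<open>n\<^sup>2 = O(D\<^sup>2)\<close>. All the constants are absolute:
  the bound obtained is \<open>200 D\<close> for every strictly convex norm.
\<close>

section \<open>Strictly convex norms\<close>

text \<open>
  Strictness says that the path from \<open>0\<close> over \<open>x\<close> to \<open>x + y\<close> can be shortest only if it does
  not leave the line through \<open>0\<close> and \<open>x\<close>.
\<close>

locale strictly_convex_norm =
  fixes N :: "'a::real_vector \<Rightarrow> real"
  assumes triangle: "N (x + y) \<le> N x + N y"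
    and homogeneous: "N (c *\<^sub>R x) = \<bar>c\<bar> * N x"
    and definite: "N x = 0 \<Longrightarrow> x = 0"
    and strict: "N (x + y) = N x + N y \<Longrightarrow> x \<noteq> 0 \<Longrightarrow> \<exists>c. y = c *\<^sub>R x"
begin

lemma N_zero [simp]: "N 0 = 0"
  using homogeneous[of 0 0] by simp

lemma N_minus [simp]: "N (- x) = N x"
  using homogeneous[of "-1" x] by simp

lemma N_commute: "N (x - y) = N (y - x)"
  using N_minus[of "x - y"] by simp

lemma N_nonneg [simp]: "0 \<le> N x"
  using triangle[of x "- x"] by simp

lemma N_eq_0_iff [simp]: "N x = 0 \<longleftrightarrow> x = 0"
  using definite by auto

lemma N_triangle_diff: "N (x - z) \<le> N (x - y) + N (y - z)"
  using triangle[of "x - y" "y - z"] by simp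

end

section \<open>The norm of a strictly convex body\<close>

lemma body_dist_translation: "body_dist K p q = body_dist K 0 (q - p)"
proof -
  have "q \<in> (\<lambda>x. p + s *\<^sub>R x) ` K \<longleftrightarrow> q - p \<in> (\<lambda>x. 0 + s *\<^sub>R x) ` K" for s
    by (auto simp: image_iff algebra_simps)
  then show ?thesis
    unfolding body_dist_def by presburger
qed

lemma body_dist_le_iff:
  assumes K: "symmetric_convex_body K" and s: "0 \<le> s"
  shows "body_dist K 0 v \<le> s \<longleftrightarrow> (\<exists>k\<in>K. v = s *\<^sub>R k)"
proof
  assume "body_dist K 0 v \<le> s"
  then obtain k m where k: "k \<in> K" "v = m *\<^sub>R k" and m: "0 \<le> m" "m \<le> s"
    using body_dist_smallest(1)[OF K, of 0 v] body_dist_smallest(2)[OF K, of v 0] by auto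
  obtain e where e: "e > 0" "cball 0 e \<subseteq> K"
    using symmetric_convex_body_contains_ball[OF K] .
  then have "0 \<in> K" by auto
  show "\<exists>k\<in>K. v = s *\<^sub>R k"
  proof (cases "s = 0")
    case True
    then show ?thesis using k m by auto
  next
    case False
    have "(m / s) *\<^sub>R k + (1 - m / s) *\<^sub>R 0 \<in> K"
      using K \<open>0 \<in> K\<close> k(1) s False m
      by (intro convexD) (auto simp: symmetric_convex_body_def)
    then have "(m / s) *\<^sub>R k \<in> K" by simp
    moreover have "v = s *\<^sub>R ((m / s) *\<^sub>R k)"
      using k(2) False by simp
    ultimately show ?thesis by blast
  qed
next
  assume "\<exists>k\<in>K. v = s *\<^sub>R k"
  then have "v \<in> (\<lambda>x. 0 + s *\<^sub>R x) ` K" by auto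
  then show "body_dist K 0 v \<le> s"
    using body_dist_smallest(3)[OF K s] by blast
qed

lemma body_unit_ball:
  assumes "symmetric_convex_body K"
  shows "{v. body_dist K 0 v \<le> 1} = K"
  using body_dist_le_iff[OF assms, of 1] by auto

text \<open>
  Only the equality case of the triangle inequality needs an idea. If \<open>N (v + w) = N v + N w\<close>, then
  the direction of \<open>v + w\<close>, scaled to norm \<open>1\<close>, lies on the segment between the unit vectors \<open>u\<close>
  of \<open>v\<close> and \<open>u'\<close> of \<open>w\<close>. The convex function \<open>N\<close> is at most \<open>1\<close> on that segment and reaches \<open>1\<close>
  in its interior, so it is constant there. The segment is thus part of the boundary of \<open>K\<close>,
  and strict convexity gives \<open>u = u'\<close>.
\<close>

lemma strictly_convex_norm_body_dist:
  assumes K: "symmetric_convex_body K" and sc: "strictly_convex_body K"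
  shows "strictly_convex_norm (body_dist K 0)"
proof
  let ?N = "body_dist K 0"
  have nonneg: "0 \<le> ?N v" for v
    using body_dist_smallest(1)[OF K] .
  have attained: "\<exists>k\<in>K. \<exists>a. a = ?N v \<and> v = a *\<^sub>R k" for v
    using body_dist_le_iff[OF K nonneg[of v], of v] by simp
  show tri: "?N (v + w) \<le> ?N v + ?N w" for v w
  proof -
    obtain k a where k: "k \<in> K" "a = ?N v" "v = a *\<^sub>R k" using attained by blast
    obtain l b where l: "l \<in> K" "b = ?N w" "w = b *\<^sub>R l" using attained by blast
    have ab: "0 \<le> a" "0 \<le> b" using k(2) l(2) nonneg by simp_all
    have "\<exists>u\<in>K. v + w = (a + b) *\<^sub>R u"
    proof (cases "a + b = 0")
      case True
      then have "a = 0" "b = 0" using ab by linarith+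
      then show ?thesis using k(1) k(3) l(3) by auto
    next
      case False
      have "(a / (a + b)) *\<^sub>R k + (b / (a + b)) *\<^sub>R l \<in> K"
        using K k(1) l(1) ab False
        by (intro convexD) (auto simp: symmetric_convex_body_def simp flip: add_divide_distrib)
      moreover have "v + w = (a + b) *\<^sub>R ((a / (a + b)) *\<^sub>R k + (b / (a + b)) *\<^sub>R l)"
        using False k(3) l(3) by (simp add: scaleR_add_right)
      ultimately show ?thesis by blast
    qed
    then have "?N (v + w) \<le> a + b"
      using body_dist_le_iff[OF K, of "a + b"] ab by simp
    then show ?thesis using k(2) l(2) by simp
  qed
  have hom_le: "?N (c *\<^sub>R v) \<le> \<bar>c\<bar> * ?N v" for c v
  proof -
    obtain k a where k: "k \<in> K" "a = ?N v" "v = a *\<^sub>R k" using attained by blast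
    have "- k \<in> K" using K k(1) by (auto simp: symmetric_convex_body_def)
    have "\<exists>l\<in>K. c *\<^sub>R v = (\<bar>c\<bar> * a) *\<^sub>R l"
    proof (cases "c \<ge> 0")
      case True
      then have "c *\<^sub>R v = (\<bar>c\<bar> * a) *\<^sub>R k" using k(3) by simp
      then show ?thesis using k(1) by blast
    next
      case False
      then have "c *\<^sub>R v = (\<bar>c\<bar> * a) *\<^sub>R (- k)" using k(3) by simp
      then show ?thesis using \<open>- k \<in> K\<close> by blast
    qed
    then have "?N (c *\<^sub>R v) \<le> \<bar>c\<bar> * a"
      using body_dist_le_iff[OF K, of "\<bar>c\<bar> * a"] nonneg[of v] k(2) by simp
    then show ?thesis using k(2) by simp
  qed
  show hom: "?N (c *\<^sub>R v) = \<bar>c\<bar> * ?N v" for c v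
  proof (cases "c = 0")
    case True
    then show ?thesis using hom_le[of 0 v] nonneg[of 0] by simp
  next
    case False
    have "?N v \<le> \<bar>1/c\<bar> * ?N (c *\<^sub>R v)"
      using hom_le[of "1/c" "c *\<^sub>R v"] False by simp
    then have "\<bar>c\<bar> * ?N v \<le> ?N (c *\<^sub>R v)"
      using False by (simp add: field_simps)
    then show ?thesis using hom_le[of c v] by linarith
  qed
  show def0: "v = 0" if "?N v = 0" for v
    using attained[of v] that by auto
  have in_K: "u \<in> K \<longleftrightarrow> ?N u \<le> 1" for u
    using body_dist_le_iff[OF K, of 1 u] by simp
  \<comment> \<open>A vector of norm \<open>1\<close> in the interior of \<open>K\<close> could be lengthened inside \<open>K\<close>.\<close>
  have sphere: "u \<in> frontier K" if "?N u = 1" for u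
  proof -
    have "u \<in> K" using in_K[of u] that by simp
    moreover have "u \<notin> interior K"
    proof
      assume "u \<in> interior K"
      then obtain e where e: "e > 0" "cball u e \<subseteq> K"
        by (auto simp: mem_interior_cball)
      have u0: "u \<noteq> 0" using that hom[of 0 u] by auto
      define t where "t = e / norm u"
      have t: "t > 0" using e u0 by (simp add: t_def)
      have "(1 + t) *\<^sub>R u \<in> cball u e"
        using e u0 by (simp add: dist_norm t_def algebra_simps)
      then have "?N ((1 + t) *\<^sub>R u) \<le> 1"
        using e(2) in_K by blast
      then show False using hom[of "1 + t" u] that t by simp
    qed
    ultimately show ?thesis
      using closure_subset by (auto simp: frontier_def)
  qed
  show "\<exists>c. w = c *\<^sub>R v" if eq: "?N (v + w) = ?N v + ?N w" and "v \<noteq> 0" for v w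
  proof (cases "w = 0")
    case True
    then show ?thesis by (auto intro: exI[of _ 0])
  next
    case False
    define a b where "a = ?N v" and "b = ?N w"
    have "a \<noteq> 0" "b \<noteq> 0"
      using def0[of v] def0[of w] \<open>v \<noteq> 0\<close> False by (auto simp: a_def b_def)
    then have ab: "a > 0" "b > 0"
      using nonneg[of v] nonneg[of w] unfolding a_def b_def by linarith+
    define u u' where "u = (1/a) *\<^sub>R v" and "u' = (1/b) *\<^sub>R w"
    have N1: "?N u = 1" "?N u' = 1"
      using ab hom by (simp_all add: u_def u'_def flip: a_def b_def)
    define \<theta> where "\<theta> = b / (a + b)"
    have \<theta>: "0 < \<theta>" "\<theta> < 1" using ab by (simp_all add: \<theta>_def)
    define m where "m = (1 - \<theta>) *\<^sub>R u + \<theta> *\<^sub>R u'"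
    have "1 - \<theta> = a / (a + b)" using ab by (simp add: \<theta>_def field_simps)
    then have "m = (1 / (a + b)) *\<^sub>R (v + w)"
      using ab by (simp add: m_def u_def u'_def \<theta>_def scaleR_add_right)
    then have Nm: "?N m = 1"
      using ab hom eq by (simp add: a_def[symmetric] b_def[symmetric])
    have Ncomb: "?N ((1 - \<tau>) *\<^sub>R u + \<tau> *\<^sub>R u') = 1" if \<tau>: "0 \<le> \<tau>" "\<tau> \<le> 1" for \<tau>
    proof (rule antisym)
      let ?w = "(1 - \<tau>) *\<^sub>R u + \<tau> *\<^sub>R u'"
      show "?N ?w \<le> 1"
        using tri[of "(1 - \<tau>) *\<^sub>R u" "\<tau> *\<^sub>R u'"] hom[of "1 - \<tau>" u] hom[of \<tau> u'] N1 \<tau> by simp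
      show "1 \<le> ?N ?w"
      proof (cases "\<tau> \<le> \<theta>")
        case True
        have "1 - \<tau> > 0" using True \<theta> by simp
        \<comment> \<open>\<open>m\<close> lies between the point at \<open>\<tau>\<close> and the endpoint \<open>u'\<close>; \<open>c\<close> is its weight on the former.\<close>
        define c where "c = (1 - \<theta>) / (1 - \<tau>)"
        have c: "0 < c" "c \<le> 1" "c * (1 - \<tau>) = 1 - \<theta>"
          using \<theta> True \<open>1 - \<tau> > 0\<close> by (auto simp: c_def field_simps)
        have "c * \<tau> + (1 - c) = \<theta>" using c(3) by (simp add: algebra_simps)
        then have "m = (c * (1 - \<tau>)) *\<^sub>R u + (c * \<tau> + (1 - c)) *\<^sub>R u'"
          unfolding m_def c(3) by simp
        then have "m = c *\<^sub>R ?w + (1 - c) *\<^sub>R u'"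
          by (simp add: algebra_simps)
        then have "1 \<le> c * ?N ?w + (1 - c)"
          using tri[of "c *\<^sub>R ?w" "(1 - c) *\<^sub>R u'"] hom[of c ?w] hom[of "1 - c" u'] N1 c Nm by simp
        then have "c * 1 \<le> c * ?N ?w" by simp
        then show ?thesis using c(1) by (simp only: mult_le_cancel_left_pos)
      next
        case False
        have "\<tau> > 0" using False \<theta> by simp
        \<comment> \<open>Now \<open>m\<close> lies between the point at \<open>\<tau>\<close> and the other endpoint \<open>u\<close>.\<close>
        define c where "c = \<theta> / \<tau>"
        have c: "0 < c" "c \<le> 1" "c * \<tau> = \<theta>"
          using \<theta> False \<open>\<tau> > 0\<close> by (auto simp: c_def field_simps)
        have "c * (1 - \<tau>) + (1 - c) = 1 - \<theta>" using c(3) by (simp add: algebra_simps)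
        then have "m = (c * (1 - \<tau>) + (1 - c)) *\<^sub>R u + (c * \<tau>) *\<^sub>R u'"
          unfolding m_def c(3) by simp
        then have "m = c *\<^sub>R ?w + (1 - c) *\<^sub>R u"
          by (simp add: algebra_simps)
        then have "1 \<le> c * ?N ?w + (1 - c)"
          using tri[of "c *\<^sub>R ?w" "(1 - c) *\<^sub>R u"] hom[of c ?w] hom[of "1 - c" u] N1 c Nm by simp
        then have "c * 1 \<le> c * ?N ?w" by simp
        then show ?thesis using c(1) by (simp only: mult_le_cancel_left_pos)
      qed
    qed
    have "closed_segment u u' \<subseteq> frontier K"
      using Ncomb sphere by (auto simp: closed_segment_def)
    then have "u = u'" using sc by (auto simp: strictly_convex_body_def)
    then have "w = b *\<^sub>R u" using ab by (simp add: u'_def)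
    then have "w = (b / a) *\<^sub>R v" by (simp add: u_def)
    then show ?thesis ..
  qed
qed

section \<open>Separated points on a line and disjoint balls\<close>

context strictly_convex_norm
begin

lemma integer_distance_ge_1:
  assumes "N (x - y) \<in> \<int>" "x \<noteq> y"
  shows "1 \<le> N (x - y)"
proof -
  have "N (x - y) > 0" using assms(2) N_nonneg[of "x - y"] less_le by fastforce
  then show ?thesis using assms(1) by (auto elim!: Ints_cases)
qed

text \<open>
  A coordinate along the line, in units of \<open>A\<close>, takes values whose integer parts are distinct.
  The last \<open>2\<close> in the bound accounts for rounding at the two ends of the interval.
\<close>

lemma card_collinear_le:
  assumes col: "collinear T" and p: "p \<in> T"
    and R: "\<And>x. x \<in> T \<Longrightarrow> N (x - p) \<le> R"
    and A: "A > 0" and sep: "\<And>x y. x \<in> T \<Longrightarrow> y \<in> T \<Longrightarrow> x \<noteq> y \<Longrightarrow> A \<le> N (x - y)"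
  shows "finite T" "real (card T) \<le> 2 * (R / A) + 2"
proof -
  obtain u where u: "\<forall>x\<in>T. \<forall>y\<in>T. \<exists>c. x - y = c *\<^sub>R u"
    using col by (auto simp: collinear_def)
  define c where "c x = (SOME k. x - p = k *\<^sub>R u)" for x
  have c: "x - p = c x *\<^sub>R u" if "x \<in> T" for x
    unfolding c_def by (rule someI_ex) (use u p that in blast)
  define t where "t x = c x * N u / A" for x
  have abs_t: "\<bar>t x - t y\<bar> = N (x - y) / A" if "x \<in> T" "y \<in> T" for x y
  proof -
    have "x - y = (c x - c y) *\<^sub>R u"
      unfolding scaleR_left_diff_distrib c[OF that(1), symmetric] c[OF that(2), symmetric] by simp
    then have "N (x - y) = \<bar>c x - c y\<bar> * N u" by (simp add: homogeneous)
    moreover have "t x - t y = (c x - c y) * N u / A"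
      by (simp add: t_def left_diff_distrib diff_divide_distrib)
    ultimately show ?thesis using A by (simp add: abs_mult)
  qed
  have inj: "inj_on (\<lambda>x. \<lfloor>t x\<rfloor>) T"
  proof (rule inj_onI, rule ccontr)
    fix x y assume xy: "x \<in> T" "y \<in> T" "\<lfloor>t x\<rfloor> = \<lfloor>t y\<rfloor>" "x \<noteq> y"
    then have "1 \<le> \<bar>t x - t y\<bar>" using abs_t[of x y] sep[of x y] A by simp
    then show False using xy(3) by linarith
  qed
  have "R \<ge> 0" using R[OF p] by simp
  define m where "m = \<lfloor>R / A\<rfloor>"
  have m: "0 \<le> m" using \<open>R \<ge> 0\<close> A by (simp add: m_def)
  have bound: "\<bar>t x\<bar> \<le> R / A" if "x \<in> T" for x
  proof -
    have "\<bar>t x\<bar> = N (x - p) / A"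
      using c[OF that] A by (simp add: t_def homogeneous abs_mult)
    then show ?thesis using R[OF that] A by (simp add: divide_right_mono)
  qed
  have "- m - 1 \<le> \<lfloor>t x\<rfloor> \<and> \<lfloor>t x\<rfloor> \<le> m" if "x \<in> T" for x
    using bound[OF that] unfolding m_def by linarith
  then have sub: "(\<lambda>x. \<lfloor>t x\<rfloor>) ` T \<subseteq> {- m - 1..m}"
    by auto
  show "finite T" using finite_imageD[OF finite_subset[OF sub] inj] by simp
  have "card T \<le> card {- m - 1..m}" using card_inj_on_le[OF inj sub] by simp
  then have "real (card T) \<le> 2 * real_of_int m + 2" using m by simp
  also have "\<dots> \<le> 2 * (R / A) + 2"
    using of_int_floor_le[of "R / A"] unfolding m_def by linarith
  finally show "real (card T) \<le> 2 * (R / A) + 2" .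
qed

text \<open>
  The greedy choice is a Vitali-type selection: the point with the largest radius is taken and its
  ball is removed. A point that is chosen later lies outside all the earlier balls, whose radii are
  at least as large as its own. So two chosen points are at least the larger of their radii apart,
  and the balls of a third of the radii are disjoint.
\<close>

lemma greedy_ball_cover:
  assumes "finite T" and pos: "\<And>p. p \<in> T \<Longrightarrow> 0 < \<rho> p"
  obtains I where "I \<subseteq> T" "\<And>p q. p \<in> I \<Longrightarrow> q \<in> I \<Longrightarrow> p \<noteq> q \<Longrightarrow> \<rho> p \<le> N (p - q)"
    "T \<subseteq> (\<Union>p\<in>I. {x \<in> T. N (x - p) < \<rho> p})"
proof -
  have "\<exists>I\<subseteq>T. (\<forall>p\<in>I. \<forall>q\<in>I. p \<noteq> q \<longrightarrow> \<rho> p \<le> N (p - q)) \<and>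
      (\<forall>x\<in>T. \<exists>p\<in>I. N (x - p) < \<rho> p)"
    using assms
  proof (induction T rule: finite_psubset_induct)
    case (psubset T)
    show ?case
    proof (cases "T = {}")
      case False
      then have "Max (\<rho> ` T) \<in> \<rho> ` T" using \<open>finite T\<close> by (intro Max_in) auto
      then obtain p where p: "p \<in> T" "Max (\<rho> ` T) = \<rho> p" by auto
      have max: "\<rho> q \<le> \<rho> p" if "q \<in> T" for q
        using Max_ge[of "\<rho> ` T" "\<rho> q"] \<open>finite T\<close> that p(2) by simp
      define T' where "T' = {x \<in> T. \<rho> p \<le> N (x - p)}"
      have "p \<notin> T'" using psubset.prems[OF p(1)] by (simp add: T'_def)
      moreover have "T' \<subseteq> T" by (auto simp: T'_def)
      ultimately have "T' \<subset> T" using p(1) by blast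
      then obtain I where I: "I \<subseteq> T'" "\<forall>p\<in>I. \<forall>q\<in>I. p \<noteq> q \<longrightarrow> \<rho> p \<le> N (p - q)"
        "\<forall>x\<in>T'. \<exists>p\<in>I. N (x - p) < \<rho> p"
        using psubset.IH[of T'] psubset.prems by blast
      have far: "\<rho> p \<le> N (q - p) \<and> \<rho> p \<le> N (p - q) \<and> \<rho> q \<le> N (q - p)" if "q \<in> I" for q
      proof -
        have "q \<in> T" "\<rho> p \<le> N (q - p)" using I(1) that by (auto simp: T'_def)
        then show ?thesis using max[of q] N_commute[of p q] by linarith
      qed
      have "insert p I \<subseteq> T" using I(1) p(1) by (auto simp: T'_def)
      moreover have "\<forall>u\<in>insert p I. \<forall>v\<in>insert p I. u \<noteq> v \<longrightarrow> \<rho> u \<le> N (u - v)"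
        using I(2) far by blast
      moreover have "\<forall>x\<in>T. \<exists>u\<in>insert p I. N (x - u) < \<rho> u"
      proof
        fix x assume "x \<in> T"
        show "\<exists>u\<in>insert p I. N (x - u) < \<rho> u"
        proof (cases "x \<in> T'")
          case True
          then show ?thesis using I(3) by blast
        next
          case False
          then show ?thesis using \<open>x \<in> T\<close> by (auto simp: T'_def)
        qed
      qed
      ultimately show ?thesis by blast
    qed auto
  qed
  then obtain I where I: "I \<subseteq> T" "\<forall>p\<in>I. \<forall>q\<in>I. p \<noteq> q \<longrightarrow> \<rho> p \<le> N (p - q)"
    "\<forall>x\<in>T. \<exists>p\<in>I. N (x - p) < \<rho> p" by blast
  show ?thesis
    by (rule that[of I]) (use I in auto)
qed

end

section \<open>Signs and differences of distances determine a point\<close>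

text \<open>Twice the signed area of the triangle \<open>abc\<close>.\<close>

definition orient :: "real^2 \<Rightarrow> real^2 \<Rightarrow> real^2 \<Rightarrow> real" where
  "orient a b c = (b$1 - a$1) * (c$2 - a$2) - (b$2 - a$2) * (c$1 - a$1)"

lemma orient_rotate: "orient b c a = orient a b c"
  by (simp add: orient_def algebra_simps)

lemma collinear_if_orient_eq_0:
  assumes "orient a b c = 0"
  shows "collinear {a, b, c}"
proof (cases "a = b")
  case False
  let ?u = "b - a" and ?v = "c - a"
  have cross: "?u$1 * ?v$2 = ?u$2 * ?v$1"
    using assms by (simp add: orient_def)
  have "\<exists>k. ?v = k *\<^sub>R ?u"
  proof (cases "?u$1 = 0")
    case True
    then have "?u$2 \<noteq> 0" using False by (auto simp: vec_eq_iff forall_2)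
    then have "?v = (?v$2 / ?u$2) *\<^sub>R ?u"
      using True cross by (auto simp: vec_eq_iff forall_2)
    then show ?thesis by blast
  next
    case u1: False
    have "?v$2 = (?v$1 / ?u$1) * ?u$2"
      using u1 cross by (simp add: field_simps)
    then have "?v = (?v$1 / ?u$1) *\<^sub>R ?u"
      using u1 by (simp add: vec_eq_iff forall_2)
    then show ?thesis by blast
  qed
  then have "collinear {0, ?u, ?v}"
    by (auto simp: collinear_lemma)
  then have "collinear {b, a, c}"
    by (subst collinear_3) auto
  then show ?thesis by (simp add: insert_commute)
qed auto

lemma orient_minus: "orient q p x = - orient p q x"
  by (simp add: orient_def algebra_simps)

lemma noncollinear_third_point:
  assumes "\<not> collinear U" "p \<in> U" "q \<in> U" "p \<noteq> q"
  obtains r where "r \<in> U" "\<not> collinear {p, q, r}"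
  using assms collinear_triples[of p q U] by (auto simp: insert_absorb)

text \<open>
  Divided by \<open>orient p q r\<close>, the three orientations are the barycentric coordinates of \<open>x\<close>. Their
  signs say in which cell of the arrangement of the lines \<open>pq\<close>, \<open>qr\<close>, \<open>rp\<close> the point lies.
\<close>

lemma orient_barycentric:
  "orient p q r *\<^sub>R x = orient q r x *\<^sub>R p + orient r p x *\<^sub>R q + orient p q x *\<^sub>R r"
  "orient p q r = orient q r x + orient r p x + orient p q x"
  by (simp_all add: orient_def vec_eq_iff forall_2 algebra_simps)

locale planar_strictly_convex_norm = strictly_convex_norm N for N :: "real^2 \<Rightarrow> real" +
  assumes unit_ball_compact: "compact {v. N v \<le> 1}"
    and unit_ball_interior: "interior {v. N v \<le> 1} \<noteq> {}"
begin

text \<open>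
  In the next two lemmas, \<open>l x + a p = m y + b q\<close> with \<open>l + a = m + b\<close> says, after division by the
  common sum of the weights, that the segments \<open>x p\<close> and \<open>y q\<close> meet in a point \<open>z\<close>. Weights
  that are not normalized fit the barycentric relations that produce the crossing.

  If \<open>a\<close> were positive, \<open>z\<close> would differ from \<open>x\<close>. Equality in the exchange at \<open>z\<close> makes
  \<open>x\<close>, \<open>z\<close>, \<open>q\<close> collinear by strictness, while \<open>x\<close>, \<open>z\<close>, \<open>p\<close> are collinear anyway. Then \<open>x\<close> is on
  the line \<open>p q\<close>, which the orientation excludes.
\<close>

lemma crossing_only_at_endpoint:
  assumes ox: "orient p q x \<noteq> 0"
    and diff: "N (x - p) - N (x - q) = N (y - p) - N (y - q)"
    and pos: "l > 0" "m > 0" "a \<ge> 0" "b \<ge> 0"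
    and sum: "l + a = m + b"
    and cross: "l *\<^sub>R x + a *\<^sub>R p = m *\<^sub>R y + b *\<^sub>R q"
  shows "a = 0"
proof (rule ccontr)
  assume "a \<noteq> 0"
  define W where "W = l + a"
  have W: "W > 0" "W = m + b" using pos sum by (auto simp: W_def)
  define z where "z = (1 / W) *\<^sub>R (l *\<^sub>R x + a *\<^sub>R p)"
  have Wz: "W *\<^sub>R z = l *\<^sub>R x + a *\<^sub>R p" "W *\<^sub>R z = m *\<^sub>R y + b *\<^sub>R q"
    using W cross by (simp_all add: z_def)
  have div: "u = (k / W) *\<^sub>R w" if "W *\<^sub>R u = k *\<^sub>R w" for u w :: "real^2" and k
  proof -
    have "u = (1 / W) *\<^sub>R (W *\<^sub>R u)" using W(1) by simp
    then show ?thesis unfolding that by simp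
  qed
  have xz: "x - z = (a / W) *\<^sub>R (x - p)"
    by (rule div) (simp add: scaleR_diff_right Wz(1), simp add: W_def algebra_simps)
  have zp: "z - p = (l / W) *\<^sub>R (x - p)"
    by (rule div) (simp add: scaleR_diff_right Wz(1), simp add: W_def algebra_simps)
  have yz: "y - z = (b / W) *\<^sub>R (y - q)"
    by (rule div) (simp add: scaleR_diff_right Wz(2), simp add: W(2) algebra_simps)
  have zq: "z - q = (m / W) *\<^sub>R (y - q)"
    by (rule div) (simp add: scaleR_diff_right Wz(2), simp add: W(2) algebra_simps)
  have "N (x - z) + N (z - p) = (a / W + l / W) * N (x - p)"
    unfolding xz zp homogeneous using pos W by (simp add: algebra_simps)
  also have "a / W + l / W = 1" using W by (simp add: W_def flip: add_divide_distrib)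
  finally have Nx: "N (x - z) + N (z - p) = N (x - p)" by simp
  have "N (y - z) + N (z - q) = (b / W + m / W) * N (y - q)"
    unfolding yz zq homogeneous using pos W by (simp add: algebra_simps)
  also have "b / W + m / W = 1" using W by (simp flip: add_divide_distrib)
  finally have Ny: "N (y - z) + N (z - q) = N (y - q)" by simp
  \<comment> \<open>Both exchanged paths \<open>x z q\<close> and \<open>y z p\<close> must be shortest, as their total length is.\<close>
  have "N (x - q) = N (x - z) + N (z - q)"
    using Nx Ny diff N_triangle_diff[of x q z] N_triangle_diff[of y p z] by linarith
  then have eq: "N ((x - z) + (z - q)) = N (x - z) + N (z - q)" by simp
  have "x \<noteq> p" using ox by (auto simp: orient_def)
  then have "x - z \<noteq> 0" using xz \<open>a \<noteq> 0\<close> W by simp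
  then obtain c where c: "z - q = c *\<^sub>R (x - z)" using strict[OF eq] by blast
  have "x - q = (x - z) + (z - q)" by simp
  also have "\<dots> = (1 + c) *\<^sub>R (x - z)" unfolding c by (simp add: algebra_simps)
  also have "\<dots> = ((1 + c) * (a / W)) *\<^sub>R (x - p)" unfolding xz by simp
  finally obtain k where "x - q = k *\<^sub>R (x - p)" by blast
  then have k: "x$1 - q$1 = k * (x$1 - p$1)" "x$2 - q$2 = k * (x$2 - p$2)"
    by (simp_all add: vec_eq_iff forall_2)
  have "orient p q x = (x$1 - p$1) * (x$2 - q$2) - (x$2 - p$2) * (x$1 - q$1)"
    by (simp add: orient_def algebra_simps)
  also have "\<dots> = 0" unfolding k by simp
  finally show False using ox by simp
qed

lemma crossing_imp_eq:
  assumes ox: "orient p q x \<noteq> 0" and oy: "orient p q y \<noteq> 0"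
    and diff: "N (x - p) - N (x - q) = N (y - p) - N (y - q)"
    and pos: "l > 0" "m > 0" "a \<ge> 0" "b \<ge> 0"
    and sum: "l + a = m + b"
    and cross: "l *\<^sub>R x + a *\<^sub>R p = m *\<^sub>R y + b *\<^sub>R q"
  shows "x = y"
proof -
  have "a = 0" by (rule crossing_only_at_endpoint[OF ox diff pos sum cross])
  moreover have "b = 0"
    by (rule crossing_only_at_endpoint[of q p y x m l])
      (use assms in \<open>auto simp: orient_minus[of q p]\<close>)
  ultimately show ?thesis using sum cross pos by simp
qed

text \<open>
  Let \<open>(\<alpha>, \<beta>, \<gamma>)\<close> and \<open>(\<alpha>', \<beta>', \<gamma>')\<close> be the barycentric coordinates of \<open>x\<close> and \<open>y\<close>, scaled by
  \<open>\<Delta> = orient p q r\<close>. The combination \<open>\<gamma>' x - \<gamma> y\<close> eliminates the vertex \<open>r\<close> and leaves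
  multiples of \<open>p\<close> and \<open>q\<close>. As \<open>\<gamma>\<close> and \<open>\<gamma>'\<close> have the same sign, \<open>x\<close> and \<open>y\<close> enter with opposite
  signs. If \<open>p\<close> and \<open>q\<close> do so too, then sorting the terms by sign exhibits a crossing of the
  segments \<open>x p\<close> and \<open>y q\<close>, or of \<open>x q\<close> and \<open>y p\<close>.
\<close>

lemma eq_if_opposite_coefficients:
  assumes nd: "orient p q r \<noteq> 0"
    and sg: "sgn (orient p q x) = sgn (orient p q y)" and ox: "orient p q x \<noteq> 0"
    and diff: "N (x - p) - N (x - q) = N (y - p) - N (y - q)"
    and opp: "(orient q r x * orient p q y - orient p q x * orient q r y) *
              (orient r p x * orient p q y - orient p q x * orient r p y) \<le> 0"
  shows "x = y"
proof -
  define \<Delta> \<alpha> \<beta> \<gamma> where "\<Delta> = orient p q r"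
    and "\<alpha> = orient q r x" and "\<beta> = orient r p x" and "\<gamma> = orient p q x"
  define \<alpha>' \<beta>' \<gamma>' where
    "\<alpha>' = orient q r y" and "\<beta>' = orient r p y" and "\<gamma>' = orient p q y"
  note defs = \<Delta>_def \<alpha>_def \<beta>_def \<gamma>_def \<alpha>'_def \<beta>'_def \<gamma>'_def
  have oy: "\<gamma>' \<noteq> 0" using sg ox by (auto simp: defs sgn_0_0)
  define A B where "A = \<alpha> * \<gamma>' - \<gamma> * \<alpha>'" and "B = \<beta> * \<gamma>' - \<gamma> * \<beta>'"
  have AB: "A * B \<le> 0" using opp by (simp add: A_def B_def defs)
  \<comment> \<open>Multiplication by \<open>\<epsilon>\<close> makes the weight of \<open>x\<close> positive.\<close>
  define \<epsilon> where "\<epsilon> = sgn \<gamma> * sgn \<Delta>"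
  have \<epsilon>: "\<epsilon> * (\<Delta> * \<gamma>') = \<bar>\<Delta>\<bar> * \<bar>\<gamma>'\<bar>" "\<epsilon> * (\<Delta> * \<gamma>) = \<bar>\<Delta>\<bar> * \<bar>\<gamma>\<bar>"
  proof -
    have sg': "sgn \<gamma> = sgn \<gamma>'" using sg by (simp add: defs)
    have "\<epsilon> * (\<Delta> * \<gamma>') = (\<Delta> * sgn \<Delta>) * (\<gamma>' * sgn \<gamma>')"
      unfolding \<epsilon>_def sg' by (simp only: mult_ac)
    then show "\<epsilon> * (\<Delta> * \<gamma>') = \<bar>\<Delta>\<bar> * \<bar>\<gamma>'\<bar>" by (simp only: abs_sgn)
    have "\<epsilon> * (\<Delta> * \<gamma>) = (\<Delta> * sgn \<Delta>) * (\<gamma> * sgn \<gamma>)"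
      unfolding \<epsilon>_def by (simp only: mult_ac)
    then show "\<epsilon> * (\<Delta> * \<gamma>) = \<bar>\<Delta>\<bar> * \<bar>\<gamma>\<bar>" by (simp only: abs_sgn)
  qed
  have bx: "\<Delta> *\<^sub>R x = \<alpha> *\<^sub>R p + \<beta> *\<^sub>R q + \<gamma> *\<^sub>R r" "\<Delta> = \<alpha> + \<beta> + \<gamma>"
    unfolding defs by (rule orient_barycentric)+
  have "by": "\<Delta> *\<^sub>R y = \<alpha>' *\<^sub>R p + \<beta>' *\<^sub>R q + \<gamma>' *\<^sub>R r" "\<Delta> = \<alpha>' + \<beta>' + \<gamma>'"
    unfolding defs by (rule orient_barycentric)+
  have "(\<Delta> * \<gamma>') *\<^sub>R x - (\<Delta> * \<gamma>) *\<^sub>R y = \<gamma>' *\<^sub>R (\<Delta> *\<^sub>R x) - \<gamma> *\<^sub>R (\<Delta> *\<^sub>R y)"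
    by (simp add: mult.commute)
  also have "\<dots> = A *\<^sub>R p + B *\<^sub>R q"
    unfolding bx(1) "by"(1) A_def B_def by (simp add: algebra_simps)
  finally have "\<epsilon> *\<^sub>R ((\<Delta> * \<gamma>') *\<^sub>R x - (\<Delta> * \<gamma>) *\<^sub>R y) = \<epsilon> *\<^sub>R (A *\<^sub>R p + B *\<^sub>R q)" by simp
  then have vec: "(\<bar>\<Delta>\<bar> * \<bar>\<gamma>'\<bar>) *\<^sub>R x - (\<bar>\<Delta>\<bar> * \<bar>\<gamma>\<bar>) *\<^sub>R y = (\<epsilon> * A) *\<^sub>R p + (\<epsilon> * B) *\<^sub>R q"
    unfolding scaleR_diff_right scaleR_add_right scaleR_scaleR \<epsilon> .
  have "\<Delta> * \<gamma>' - \<Delta> * \<gamma> = (\<alpha> + \<beta> + \<gamma>) * \<gamma>' - (\<alpha>' + \<beta>' + \<gamma>') * \<gamma>"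
    using bx(2) "by"(2) by simp
  also have "\<dots> = A + B" by (simp add: A_def B_def algebra_simps)
  finally have "\<epsilon> * (\<Delta> * \<gamma>') - \<epsilon> * (\<Delta> * \<gamma>) = \<epsilon> * A + \<epsilon> * B"
    by (simp flip: right_diff_distrib distrib_left)
  then have sum: "\<bar>\<Delta>\<bar> * \<bar>\<gamma>'\<bar> - \<bar>\<Delta>\<bar> * \<bar>\<gamma>\<bar> = \<epsilon> * A + \<epsilon> * B"
    unfolding \<epsilon> .
  have pos: "\<bar>\<Delta>\<bar> * \<bar>\<gamma>'\<bar> > 0" "\<bar>\<Delta>\<bar> * \<bar>\<gamma>\<bar> > 0"
    using nd ox oy by (simp_all add: defs)
  have "(\<epsilon> * A) * (\<epsilon> * B) = \<epsilon>\<^sup>2 * (A * B)" by (simp add: power2_eq_square)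
  also have "\<dots> \<le> 0" using AB by (rule mult_nonneg_nonpos[OF zero_le_power2])
  finally have le: "(\<epsilon> * A) * (\<epsilon> * B) \<le> 0" .
  have shift: "u + - s = v + t" "u + - t = v + s" if "u - v = s + t" for u v s t :: "real^2"
    using that by (simp_all add: algebra_simps)
  from le consider "\<epsilon> * A \<le> 0" "\<epsilon> * B \<ge> 0" | "\<epsilon> * A \<ge> 0" "\<epsilon> * B \<le> 0"
    by (auto simp: mult_le_0_iff)
  then show ?thesis
  proof cases
    case 1
    show ?thesis
    proof (rule crossing_imp_eq[OF ox _ diff pos])
      show "orient p q y \<noteq> 0" using oy by (simp add: defs)
      show "- (\<epsilon> * A) \<ge> 0" "\<epsilon> * B \<ge> 0" using 1 by simp_all
      show "\<bar>\<Delta>\<bar> * \<bar>\<gamma>'\<bar> + - (\<epsilon> * A) = \<bar>\<Delta>\<bar> * \<bar>\<gamma>\<bar> + \<epsilon> * B" using sum by linarith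
      show "(\<bar>\<Delta>\<bar> * \<bar>\<gamma>'\<bar>) *\<^sub>R x + - (\<epsilon> * A) *\<^sub>R p = (\<bar>\<Delta>\<bar> * \<bar>\<gamma>\<bar>) *\<^sub>R y + (\<epsilon> * B) *\<^sub>R q"
        unfolding scaleR_minus_left by (rule shift(1)[OF vec])
    qed
  next
    case 2
    show ?thesis
    proof (rule crossing_imp_eq[OF _ _ _ pos])
      show "orient q p x \<noteq> 0" "orient q p y \<noteq> 0"
        using ox oy by (simp_all add: defs orient_minus[of q p])
      show "N (x - q) - N (x - p) = N (y - q) - N (y - p)" using diff by simp
      show "- (\<epsilon> * B) \<ge> 0" "\<epsilon> * A \<ge> 0" using 2 by simp_all
      show "\<bar>\<Delta>\<bar> * \<bar>\<gamma>'\<bar> + - (\<epsilon> * B) = \<bar>\<Delta>\<bar> * \<bar>\<gamma>\<bar> + \<epsilon> * A" using sum by linarith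
      show "(\<bar>\<Delta>\<bar> * \<bar>\<gamma>'\<bar>) *\<^sub>R x + - (\<epsilon> * B) *\<^sub>R q = (\<bar>\<Delta>\<bar> * \<bar>\<gamma>\<bar>) *\<^sub>R y + (\<epsilon> * A) *\<^sub>R p"
        unfolding scaleR_minus_left by (rule shift(2)[OF vec])
    qed
  qed
qed

text \<open>
  The coefficients that arise from eliminating each of the vertices are, up to sign, pairs of entries
  of the cross product \<open>(X, Y, Z)\<close> of the two coordinate vectors. Two of the three entries have the
  same weak sign, and for them the remaining coefficients are opposite. So some
  elimination always produces a crossing, no matter which cell contains \<open>x\<close> and \<open>y\<close>.
\<close>

lemma eq_if_same_signs_and_differences:
  assumes nd: "orient p q r \<noteq> 0"
    and sg: "sgn (orient p q x) = sgn (orient p q y)"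
      "sgn (orient q r x) = sgn (orient q r y)"
      "sgn (orient r p x) = sgn (orient r p y)"
    and diff: "N (x - p) - N (x - q) = N (y - p) - N (y - q)"
      "N (x - p) - N (x - r) = N (y - p) - N (y - r)"
  shows "x = y"
proof -
  define \<alpha> \<beta> \<gamma> where "\<alpha> = orient q r x" and "\<beta> = orient r p x" and "\<gamma> = orient p q x"
  define \<alpha>' \<beta>' \<gamma>' where
    "\<alpha>' = orient q r y" and "\<beta>' = orient r p y" and "\<gamma>' = orient p q y"
  note defs = \<alpha>_def \<beta>_def \<gamma>_def \<alpha>'_def \<beta>'_def \<gamma>'_def
  define X Y Z where "X = \<beta> * \<gamma>' - \<gamma> * \<beta>'" and "Y = \<gamma> * \<alpha>' - \<alpha> * \<gamma>'" and "Z = \<alpha> * \<beta>' - \<beta> * \<alpha>'"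
  note XYZ = X_def Y_def Z_def
  have rot: "orient q r p \<noteq> 0" "orient r p q \<noteq> 0"
    using nd by (simp_all add: orient_rotate orient_rotate[of r p q])
  have 1: "x = y" if "\<gamma> \<noteq> 0" "X * Y \<ge> 0"
  proof (rule eq_if_opposite_coefficients[OF nd sg(1) _ diff(1)])
    show "orient p q x \<noteq> 0" using that by (simp add: defs)
    have "(\<alpha> * \<gamma>' - \<gamma> * \<alpha>') * (\<beta> * \<gamma>' - \<gamma> * \<beta>') = - (X * Y)" by (simp add: XYZ algebra_simps)
    then show "(orient q r x * orient p q y - orient p q x * orient q r y) *
        (orient r p x * orient p q y - orient p q x * orient r p y) \<le> 0"
      using that by (simp add: defs)
  qed
  have 2: "x = y" if "\<alpha> \<noteq> 0" "Y * Z \<ge> 0"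
  proof (rule eq_if_opposite_coefficients[OF rot(1) sg(2)])
    show "orient q r x \<noteq> 0" using that by (simp add: defs)
    show "N (x - q) - N (x - r) = N (y - q) - N (y - r)" using diff by linarith
    have "(\<beta> * \<alpha>' - \<alpha> * \<beta>') * (\<gamma> * \<alpha>' - \<alpha> * \<gamma>') = - (Y * Z)" by (simp add: XYZ algebra_simps)
    then show "(orient r p x * orient q r y - orient q r x * orient r p y) *
        (orient p q x * orient q r y - orient q r x * orient p q y) \<le> 0"
      using that by (simp add: defs)
  qed
  have 3: "x = y" if "\<beta> \<noteq> 0" "Z * X \<ge> 0"
  proof (rule eq_if_opposite_coefficients[OF rot(2) sg(3)])
    show "orient r p x \<noteq> 0" using that by (simp add: defs)
    show "N (x - r) - N (x - p) = N (y - r) - N (y - p)" using diff by linarith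
    have "(\<gamma> * \<beta>' - \<beta> * \<gamma>') * (\<alpha> * \<beta>' - \<beta> * \<alpha>') = - (Z * X)" by (simp add: XYZ algebra_simps)
    then show "(orient p q x * orient r p y - orient r p x * orient p q y) *
        (orient q r x * orient r p y - orient r p x * orient q r y) \<le> 0"
      using that by (simp add: defs)
  qed
  have zero_iff: "u = 0 \<longleftrightarrow> v = 0" if "sgn u = sgn v" for u v :: real
    using that by (metis sgn_0_0)
  have zero: "\<alpha> = 0 \<longleftrightarrow> \<alpha>' = 0" "\<beta> = 0 \<longleftrightarrow> \<beta>' = 0" "\<gamma> = 0 \<longleftrightarrow> \<gamma>' = 0"
    unfolding defs by (rule zero_iff, rule sg)+
  have "\<alpha> + \<beta> + \<gamma> \<noteq> 0" using orient_barycentric(2)[of p q r x] nd by (simp add: defs)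
  show ?thesis
  proof (cases "\<alpha> = 0 \<or> \<beta> = 0 \<or> \<gamma> = 0")
    case True
    \<comment> \<open>On a side line two entries of the cross product vanish, so every elimination is allowed
      whose own coordinate is not \<open>0\<close>.\<close>
    then have "X * Y = 0" "Y * Z = 0" "Z * X = 0"
      using zero by (auto simp: XYZ)
    moreover have "\<alpha> \<noteq> 0 \<or> \<beta> \<noteq> 0 \<or> \<gamma> \<noteq> 0" using \<open>\<alpha> + \<beta> + \<gamma> \<noteq> 0\<close> by auto
    ultimately show ?thesis using 1 2 3 by linarith
  next
    case False
    have "X * Y \<ge> 0 \<or> Y * Z \<ge> 0 \<or> Z * X \<ge> 0"
      unfolding zero_le_mult_iff by linarith
    then show ?thesis using 1 2 3 False by blast
  qed
qed

text \<open>
  The Erdos-Anning bound: the points are classified by the two integer differences and by three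
  signs, which gives the factor \<open>27 = 3 * 3 * 3\<close>.
\<close>

lemma card_le_if_integer_distances_to_triangle:
  assumes nc: "\<not> collinear {p, q, r}"
    and int: "\<And>x. x \<in> S \<Longrightarrow> N (x - p) \<in> \<int> \<and> N (x - q) \<in> \<int> \<and> N (x - r) \<in> \<int>"
    and a: "N (p - q) \<le> real a" and b: "N (p - r) \<le> real b"
  shows "finite S" "card S \<le> 27 * (2 * a + 1) * (2 * b + 1)"
proof -
  have nd: "orient p q r \<noteq> 0" using nc collinear_if_orient_eq_0 by blast
  define f where "f x = (\<lfloor>N (x - p) - N (x - q)\<rfloor>, \<lfloor>N (x - p) - N (x - r)\<rfloor>,
      sgn (orient p q x), sgn (orient q r x), sgn (orient r p x))" for x
  define B :: "(int \<times> int \<times> real \<times> real \<times> real) set"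
    where "B = {- int a..int a} \<times> {- int b..int b} \<times> {-1, 0, 1} \<times> {-1, 0, 1} \<times> {-1, 0, 1}"
  have inj: "inj_on f S"
  proof (rule inj_onI)
    fix x y assume xy: "x \<in> S" "y \<in> S" "f x = f y"
    have fl: "u = v" if "u \<in> \<int>" "v \<in> \<int>" "\<lfloor>u\<rfloor> = \<lfloor>v\<rfloor>" for u v :: real
      using that by (auto elim!: Ints_cases)
    have eqs: "\<lfloor>N (x - p) - N (x - q)\<rfloor> = \<lfloor>N (y - p) - N (y - q)\<rfloor>"
      "\<lfloor>N (x - p) - N (x - r)\<rfloor> = \<lfloor>N (y - p) - N (y - r)\<rfloor>"
      "sgn (orient p q x) = sgn (orient p q y)"
      "sgn (orient q r x) = sgn (orient q r y)"
      "sgn (orient r p x) = sgn (orient r p y)"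
      using xy(3) by (simp_all only: f_def prod.inject)
    show "x = y"
    proof (rule eq_if_same_signs_and_differences[OF nd eqs(3-5)])
      show "N (x - p) - N (x - q) = N (y - p) - N (y - q)"
        by (rule fl[OF _ _ eqs(1)]) (use int[OF xy(1)] int[OF xy(2)] in simp_all)
      show "N (x - p) - N (x - r) = N (y - p) - N (y - r)"
        by (rule fl[OF _ _ eqs(2)]) (use int[OF xy(1)] int[OF xy(2)] in simp_all)
    qed
  qed
  have sub: "f ` S \<subseteq> B"
  proof (rule image_subsetI)
    fix x
    have fl: "\<lfloor>N (x - p) - N (x - s)\<rfloor> \<in> {- int k..int k}"
      if "N (p - s) \<le> real k" for s k
    proof -
      have "N (x - p) - N (x - s) \<le> real k" "- real k \<le> N (x - p) - N (x - s)"
        using that N_triangle_diff[of x p s] N_triangle_diff[of x s p] N_commute[of s p] by linarith+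
      then have "- int k \<le> \<lfloor>N (x - p) - N (x - s)\<rfloor>" "\<lfloor>N (x - p) - N (x - s)\<rfloor> \<le> int k"
        by linarith+
      then show ?thesis by simp
    qed
    have sgn: "sgn t \<in> {-1, 0, 1}" for t :: real by (simp add: sgn_if)
    show "f x \<in> B"
      unfolding B_def f_def by (intro SigmaI fl a b sgn)
  qed
  have fin: "finite B" by (simp add: B_def)
  have card: "card B = 27 * (2 * a + 1) * (2 * b + 1)"
  proof -
    have "nat (2 * int k + 1) = 2 * k + 1" for k :: nat by linarith
    then show ?thesis by (simp add: B_def card_cartesian_product) (simp add: algebra_simps)
  qed
  show "finite S" by (rule finite_imageD[OF finite_subset[OF sub fin] inj])
  show "card S \<le> 27 * (2 * a + 1) * (2 * b + 1)"
    using card_inj_on_le[OF inj sub fin] unfolding card .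
qed

section \<open>Packing disjoint balls by area\<close>

text \<open>
  The balls of radius \<open>\<rho> p / 3\<close> are disjoint and contained in the ball of radius \<open>D + D / 3\<close>
  around \<open>c\<close>; areas scale with the square of the radius.
\<close>

lemma sum_squares_of_separated_radii_le:
  assumes fin: "finite I" and \<rho>: "\<And>p. p \<in> I \<Longrightarrow> 0 < \<rho> p \<and> \<rho> p \<le> D"
    and near: "\<And>p. p \<in> I \<Longrightarrow> N (p - c) \<le> D"
    and sep: "\<And>p q. p \<in> I \<Longrightarrow> q \<in> I \<Longrightarrow> p \<noteq> q \<Longrightarrow> \<rho> p \<le> N (p - q)"
  shows "(\<Sum>p\<in>I. (\<rho> p)\<^sup>2) \<le> 16 * D\<^sup>2"
proof (cases "I = {}")
  case False
  then have D: "D > 0" using \<rho> by fastforce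
  define K where "K = {v. N v \<le> 1}"
  define cell where "cell r p = (\<lambda>v. r *\<^sub>R v + p) ` K" for r and p :: "real^2"
  have cell: "x \<in> cell r p \<longleftrightarrow> N (x - p) \<le> r" if "r > 0" for x r p
  proof
    assume "x \<in> cell r p"
    then show "N (x - p) \<le> r"
      using that by (auto simp: cell_def K_def homogeneous mult_left_le)
  next
    assume "N (x - p) \<le> r"
    then have "(1 / r) *\<^sub>R (x - p) \<in> K" using that by (simp add: K_def homogeneous)
    moreover have "x = r *\<^sub>R ((1 / r) *\<^sub>R (x - p)) + p" using that by simp
    ultimately show "x \<in> cell r p" unfolding cell_def by blast
  qed
  have "compact K" using unit_ball_compact by (simp add: K_def)
  then have meas: "cell r p \<in> lmeasurable" for r p
    unfolding cell_def
    by (intro lmeasurable_compact compact_continuous_image continuous_intros)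
  have area: "measure lebesgue (cell r p) = r\<^sup>2 * measure lebesgue K" for r p
    unfolding cell_def by (subst measure_lebesgue_affine) simp
  have "\<not> negligible K"
  proof
    assume "negligible K"
    then have "negligible (interior K)" by (rule negligible_subset) (rule interior_subset)
    then show False
      using open_not_negligible[OF open_interior, of K] unit_ball_interior by (simp add: K_def)
  qed
  then have "measure lebesgue K \<noteq> 0"
    using lmeasurable_compact[OF \<open>compact K\<close>] by (auto simp: negligible_iff_measure)
  then have posK: "measure lebesgue K > 0"
    using measure_nonneg[of lebesgue K] by linarith
  have disj: "pairwise (\<lambda>p q. disjnt (cell (\<rho> p / 3) p) (cell (\<rho> q / 3) q)) I"
  proof (rule pairwiseI, unfold disjnt_iff, rule allI, rule notI)
    fix p q x assume pq: "p \<in> I" "q \<in> I" "p \<noteq> q"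
      and "x \<in> cell (\<rho> p / 3) p \<and> x \<in> cell (\<rho> q / 3) q"
    then have "N (x - p) \<le> \<rho> p / 3" "N (x - q) \<le> \<rho> q / 3"
      using cell \<rho> by auto
    then show False
      using N_triangle_diff[of p q x] N_commute[of x p] N_commute[of p q]
        sep[OF pq] sep[OF pq(2,1)] pq(3) \<rho>[OF pq(1)] by argo
  qed
  have "cell (\<rho> p / 3) p \<subseteq> cell (4 * D / 3) c" if "p \<in> I" for p
  proof
    fix x assume "x \<in> cell (\<rho> p / 3) p"
    then have "N (x - p) \<le> \<rho> p / 3" using cell \<rho> that by auto
    then have "N (x - c) \<le> 4 * D / 3"
      using N_triangle_diff[of x c p] near[OF that] \<rho>[OF that] by linarith
    then show "x \<in> cell (4 * D / 3) c" using cell D by auto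
  qed
  then have "measure lebesgue (\<Union>p\<in>I. cell (\<rho> p / 3) p) \<le> measure lebesgue (cell (4 * D / 3) c)"
    using fin meas by (intro measure_mono_fmeasurable) (auto intro!: sets.finite_UN fmeasurableD)
  also have "measure lebesgue (\<Union>p\<in>I. cell (\<rho> p / 3) p) = (\<Sum>p\<in>I. measure lebesgue (cell (\<rho> p / 3) p))"
    by (rule measure_UNION'[OF fin meas disj])
  finally have "(\<Sum>p\<in>I. (\<rho> p / 3)\<^sup>2) * measure lebesgue K \<le> (4 * D / 3)\<^sup>2 * measure lebesgue K"
    unfolding area by (simp only: sum_distrib_right)
  then have "(\<Sum>p\<in>I. (\<rho> p / 3)\<^sup>2) \<le> (4 * D / 3)\<^sup>2"
    using posK by simp
  then show ?thesis by (simp add: power_divide power_mult_distrib flip: sum_divide_distrib)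
qed simp

section \<open>Sets with integer distances\<close>

text \<open>
  This is where the two bounds are traded against each other. A small distance \<open>a\<close> between
  neighbours on the line allows many points in the ball but gives a thin triangle, and the
  Erdos-Anning bound for that triangle makes \<open>S\<close> small; the product does not depend on \<open>a\<close>.
  If \<open>p\<close> is the only point of the open ball, a triangle of points of the closed ball with \<open>p\<close> as
  a vertex is good enough.
\<close>

lemma card_times_card_ball_le:
  assumes int: "\<And>x y. x \<in> S \<Longrightarrow> y \<in> S \<Longrightarrow> N (x - y) \<in> \<int>" and p: "p \<in> S"
    and nc: "\<not> collinear {x \<in> S. N (x - p) \<le> real k}"
    and col: "collinear {x \<in> S. N (x - p) < real k}"
  shows "real (card S) * real (card {x \<in> S. N (x - p) < real k}) \<le> 2430 * (real k)\<^sup>2"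
proof -
  define U T where "U = {x \<in> S. N (x - p) \<le> real k}" and "T = {x \<in> S. N (x - p) < real k}"
  have pU: "p \<in> U" using p by (simp add: U_def)
  have ncU: "\<not> collinear U" using nc by (simp add: U_def)
  have "\<not> U \<subseteq> {p}" using ncU collinear_subset[of "{p}" U] by auto
  then obtain q where q: "q \<in> U" "q \<noteq> p" by blast
  then have "1 \<le> N (q - p)" using int[of q p] p by (intro integer_distance_ge_1) (auto simp: U_def)
  then have k: "k \<ge> 1" using q by (auto simp: U_def)
  obtain r where r: "r \<in> U" "\<not> collinear {p, q, r}"
    using noncollinear_third_point[OF ncU pU q(1)] q(2) by metis
  have triangle: "finite S \<and> card S \<le> 27 * (2 * a + 1) * (2 * b + 1)"
    if "u \<in> U" "v \<in> U" "w \<in> U" "\<not> collinear {u, v, w}"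
      "N (u - v) \<le> real a" "N (u - w) \<le> real b" for u v w a b
    using card_le_if_integer_distances_to_triangle[OF that(4) _ that(5,6), of S] that(1-3) int
    by (auto simp: U_def)
  have S1: "finite S" "card S \<le> 27 * (2 * k + 1) * (2 * k + 1)"
    using triangle[OF pU q(1) r, of k k] q(1) r(1) N_commute[of p] by (auto simp: U_def)
  have T: "finite T" "T \<subseteq> U" "p \<in> T" using S1(1) p k by (auto simp: T_def U_def)
  have "real (card S) * real (card T) \<le> 2430 * (real k)\<^sup>2"
  proof (cases "\<exists>x\<in>T. \<exists>y\<in>T. x \<noteq> y")
    case False
    then have "T = {p}" using T(3) by blast
    have "card S \<le> 27 * (3 * k) * (3 * k)"
      by (rule order.trans[OF S1(2)]) (use k in \<open>intro mult_mono, auto\<close>)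
    then have "card S \<le> 2430 * k\<^sup>2" by (simp add: power2_eq_square)
    then have "real (card S) \<le> real (2430 * k\<^sup>2)" by (simp only: of_nat_le_iff)
    then show ?thesis using \<open>T = {p}\<close> by simp
  next
    case True
    define P where "P = {(x, y). x \<in> T \<and> y \<in> T \<and> x \<noteq> y}"
    have "finite P" by (rule finite_subset[of _ "T \<times> T"]) (auto simp: P_def T(1))
    moreover have "P \<noteq> {}" using True by (auto simp: P_def)
    ultimately obtain z where "is_arg_min (\<lambda>z. N (fst z - snd z)) (\<lambda>z. z \<in> P) z"
      using ex_is_arg_min_if_finite by blast
    then have z: "z \<in> P" "\<And>w. w \<in> P \<Longrightarrow> N (fst z - snd z) \<le> N (fst w - snd w)"
      unfolding is_arg_min_linorder by blast+
    define u v where "u = fst z" and "v = snd z"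
    have uv: "u \<in> T" "v \<in> T" "u \<noteq> v" using z(1) by (auto simp: P_def u_def v_def)
    have closest: "N (u - v) \<le> N (x - y)" if "x \<in> T" "y \<in> T" "x \<noteq> y" for x y
      using z(2)[of "(x, y)"] that by (simp add: P_def u_def v_def)
    have uvint: "N (u - v) \<in> \<int>" using int uv by (auto simp: T_def)
    define a where "a = nat \<lfloor>N (u - v)\<rfloor>"
    have a: "N (u - v) = real a"
      using uvint N_nonneg[of "u - v"] by (auto simp: a_def elim!: Ints_cases)
    have a1: "a \<ge> 1" using integer_distance_ge_1[OF uvint uv(3)] a by simp
    have "N (u - v) \<le> N (u - p) + N (v - p)"
      using N_triangle_diff[of u v p] N_commute[of p v] by simp
    then have a2: "real a \<le> 2 * real k" using a uv by (auto simp: T_def)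
    obtain w where w: "w \<in> U" "\<not> collinear {u, v, w}"
      using noncollinear_third_point[OF ncU _ _ uv(3)] uv T(2) by blast
    have "N (u - w) \<le> real (2 * k)"
      using N_triangle_diff[of u w p] N_commute[of p w] uv(1) w(1) by (auto simp: T_def U_def)
    then have "card S \<le> 27 * (2 * a + 1) * (2 * (2 * k) + 1)"
      using triangle[OF _ _ w, of a "2 * k"] uv T(2) a by auto
    also have "\<dots> \<le> 27 * (3 * a) * (5 * k)"
      using a1 k by (intro mult_mono) auto
    finally have "real (card S) \<le> real (27 * (3 * a) * (5 * k))" by (simp only: of_nat_le_iff)
    then have cS: "real (card S) \<le> 405 * real a * real k" by simp
    \<comment> \<open>The rounding term \<open>2\<close> is absorbed since \<open>a \<le> 2 k\<close>.\<close>
    have "real (card T) \<le> 2 * (real k / real a) + 2"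
    proof (rule card_collinear_le(2)[of T p])
      show "collinear T" using col by (simp add: T_def)
    qed (use T(3) closest a a1 in \<open>auto simp: T_def\<close>)
    also have "\<dots> \<le> 6 * (real k / real a)"
      using a1 a2 by (simp add: field_simps)
    finally have cT: "real (card T) \<le> 6 * (real k / real a)" .
    have "real (card S) * real (card T) \<le> (405 * real a * real k) * (6 * (real k / real a))"
      by (rule mult_mono[OF cS cT]) auto
    also have "\<dots> = 2430 * (real k)\<^sup>2" using a1 by (simp add: power2_eq_square)
    finally show ?thesis .
  qed
  then show ?thesis by (simp only: T_def)
qed

lemma card_le_if_integer_distances:
  assumes int: "\<And>x y. x \<in> S \<Longrightarrow> y \<in> S \<Longrightarrow> N (x - y) \<in> \<int>"
    and pq: "p \<in> S" "q \<in> S" "p \<noteq> q"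
    and D: "\<And>x y. x \<in> S \<Longrightarrow> y \<in> S \<Longrightarrow> N (x - y) \<le> real D"
  shows "finite S \<and> real (card S) \<le> 200 * real D"
proof (cases "collinear S")
  case True
  have "1 \<le> N (p - q)" using int pq by (intro integer_distance_ge_1) auto
  then have "1 \<le> real D" using D[OF pq(1,2)] by linarith
  moreover have "finite S \<and> real (card S) \<le> 2 * (real D / 1) + 2"
    using card_collinear_le[OF True pq(1), of "real D" 1] D pq(1) int integer_distance_ge_1 by auto
  ultimately show ?thesis by auto
next
  case False
  obtain r where r: "r \<in> S" "\<not> collinear {p, q, r}"
    using noncollinear_third_point[OF False pq] .
  have fin: "finite S"
    by (rule card_le_if_integer_distances_to_triangle(1)[OF r(2), of S D D]) (use int D pq r(1) in auto)
  \<comment> \<open>As distances are integers, the open ball of radius \<open>\<rho> x\<close> contains the same points of \<open>S\<close> as the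
    closed ball of radius \<open>\<rho> x - 1\<close>, which are collinear by minimality.\<close>
  define \<rho> where "\<rho> x = (LEAST k. \<not> collinear {y \<in> S. N (y - x) \<le> real k})" for x
  have whole: "{y \<in> S. N (y - x) \<le> real D} = S" if "x \<in> S" for x
    using D that by auto
  have nc: "\<not> collinear {y \<in> S. N (y - x) \<le> real (\<rho> x)}" if "x \<in> S" for x
    unfolding \<rho>_def by (rule LeastI[of _ D]) (use whole[OF that] False in simp)
  have \<rho>_le: "\<rho> x \<le> D" if "x \<in> S" for x
    unfolding \<rho>_def by (rule Least_le) (use whole[OF that] False in simp)
  have \<rho>_pos: "\<rho> x > 0" if "x \<in> S" for x
  proof (rule ccontr)
    assume "\<not> \<rho> x > 0"
    then have "{y \<in> S. N (y - x) \<le> real (\<rho> x)} \<subseteq> {x}"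
    proof (intro subsetI)
      fix y assume "y \<in> {y \<in> S. N (y - x) \<le> real (\<rho> x)}"
      then have "N (y - x) = 0" using \<open>\<not> \<rho> x > 0\<close> by (intro order.antisym N_nonneg) simp
      then show "y \<in> {x}" by simp
    qed
    then show False using nc[OF that] collinear_subset[of "{x}"] by auto
  qed
  have col: "collinear {y \<in> S. N (y - x) < real (\<rho> x)}" if x: "x \<in> S" for x
  proof -
    have "N (y - x) \<le> real (\<rho> x - 1)" if y: "y \<in> S" "N (y - x) < real (\<rho> x)" for y
    proof -
      obtain i where i: "N (y - x) = of_int i" using int[OF y(1) x] Ints_cases by blast
      then have "i < int (\<rho> x)" using y(2) by simp
      then have "i \<le> int (\<rho> x - 1)" using \<rho>_pos[OF x] by simp
      then show ?thesis unfolding i by linarith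
    qed
    then have "{y \<in> S. N (y - x) < real (\<rho> x)} \<subseteq> {y \<in> S. N (y - x) \<le> real (\<rho> x - 1)}" by auto
    moreover have "collinear {y \<in> S. N (y - x) \<le> real (\<rho> x - 1)}"
      using not_less_Least[of "\<rho> x - 1" "\<lambda>k. \<not> collinear {y \<in> S. N (y - x) \<le> real k}",
          folded \<rho>_def] \<rho>_pos[OF x]
      by simp
    ultimately show ?thesis by (rule collinear_subset[rotated])
  qed
  obtain I where I: "I \<subseteq> S" "\<And>x y. x \<in> I \<Longrightarrow> y \<in> I \<Longrightarrow> x \<noteq> y \<Longrightarrow> real (\<rho> x) \<le> N (x - y)"
    "S \<subseteq> (\<Union>x\<in>I. {y \<in> S. N (y - x) < real (\<rho> x)})"
    by (rule greedy_ball_cover[OF fin, of "\<lambda>x. real (\<rho> x)"]) (simp add: \<rho>_pos, blast intro: that)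
  have finI: "finite I" using I(1) fin finite_subset by blast
  have "(\<Union>x\<in>I. {y \<in> S. N (y - x) < real (\<rho> x)}) = S" using I(3) by blast
  then have "card S \<le> (\<Sum>x\<in>I. card {y \<in> S. N (y - x) < real (\<rho> x)})"
    using card_UN_le[OF finI, of "\<lambda>x. {y \<in> S. N (y - x) < real (\<rho> x)}"] by simp
  then have "real (card S) \<le> real (\<Sum>x\<in>I. card {y \<in> S. N (y - x) < real (\<rho> x)})"
    by (simp only: of_nat_le_iff)
  then have "real (card S) * real (card S) \<le>
      real (card S) * (\<Sum>x\<in>I. real (card {y \<in> S. N (y - x) < real (\<rho> x)}))"
    by (intro mult_left_mono) simp_all
  also have "\<dots> = (\<Sum>x\<in>I. real (card S) * real (card {y \<in> S. N (y - x) < real (\<rho> x)}))"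
    by (rule sum_distrib_left)
  also have "\<dots> \<le> (\<Sum>x\<in>I. 2430 * (real (\<rho> x))\<^sup>2)"
  proof (rule sum_mono)
    fix x assume "x \<in> I"
    then have "x \<in> S" using I(1) by blast
    show "real (card S) * real (card {y \<in> S. N (y - x) < real (\<rho> x)}) \<le> 2430 * (real (\<rho> x))\<^sup>2"
      by (rule card_times_card_ball_le[OF int \<open>x \<in> S\<close> nc[OF \<open>x \<in> S\<close>] col[OF \<open>x \<in> S\<close>]])
  qed
  also have "\<dots> = 2430 * (\<Sum>x\<in>I. (real (\<rho> x))\<^sup>2)" by (rule sum_distrib_left[symmetric])
  also have "\<dots> \<le> 2430 * (16 * (real D)\<^sup>2)"
  proof (rule mult_left_mono[OF sum_squares_of_separated_radii_le[OF finI]])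
    show "0 < real (\<rho> x) \<and> real (\<rho> x) \<le> real D" if "x \<in> I" for x
      using that I(1) \<rho>_pos \<rho>_le by auto
    show "N (x - p) \<le> real D" if "x \<in> I" for x
      using that I(1) D pq(1) by blast
  qed (use I(2) in auto)
  also have "\<dots> \<le> (200 * real D)\<^sup>2" by (simp add: power_mult_distrib)
  finally have "(real (card S))\<^sup>2 \<le> (200 * real D)\<^sup>2" by (simp only: power2_eq_square)
  then have "real (card S) \<le> 200 * real D" by (rule power2_le_imp_le) simp
  then show ?thesis using fin by simp
qed

end

section \<open>Convex distance functions\<close>

theorem theorem3:
  fixes d :: "real^2 \<Rightarrow> real^2 \<Rightarrow> real"
  assumes "strictly_convex_distance d"
  shows "\<exists>C::real. \<forall>S::(real^2) set.
           (\<exists>p\<in>S. \<exists>q\<in>S. p \<noteq> q) \<longrightarrow>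
           (\<forall>p\<in>S. \<forall>q\<in>S. d p q \<in> \<int>) \<longrightarrow>
           bdd_above {d p q | p q. p \<in> S \<and> q \<in> S} \<longrightarrow>
           finite S \<and> real (card S) \<le> C * Sup {d p q | p q. p \<in> S \<and> q \<in> S}"
proof -
  obtain K where K: "symmetric_convex_body K" "strictly_convex_body K" and d: "d = body_dist K"
    using assms by (auto simp: strictly_convex_distance_def)
  interpret strictly_convex_norm "body_dist K 0"
    by (rule strictly_convex_norm_body_dist[OF K])
  interpret planar_strictly_convex_norm "body_dist K 0"
  proof
    show "compact {v. body_dist K 0 v \<le> 1}" "interior {v. body_dist K 0 v \<le> 1} \<noteq> {}"
      unfolding body_unit_ball[OF K(1)] using K(1) by (auto simp: symmetric_convex_body_def)
  qed
  have d_norm: "d p q = body_dist K 0 (q - p)" for p q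
    unfolding d by (rule body_dist_translation)
  show ?thesis
  proof (intro exI[of _ 200] allI impI)
    fix S :: "(real^2) set"
    assume "\<exists>p\<in>S. \<exists>q\<in>S. p \<noteq> q" and int: "\<forall>p\<in>S. \<forall>q\<in>S. d p q \<in> \<int>"
      and bdd: "bdd_above {d p q | p q. p \<in> S \<and> q \<in> S}"
    then obtain p q where pq: "p \<in> S" "q \<in> S" "p \<noteq> q" by blast
    define M where "M = Sup {d p q | p q. p \<in> S \<and> q \<in> S}"
    have le: "d x y \<le> M" if "x \<in> S" "y \<in> S" for x y
      unfolding M_def by (rule cSup_upper[OF _ bdd]) (use that in blast)
    have "0 \<le> M" using le[OF pq(1,1)] unfolding d_norm by simp
    \<comment> \<open>Integer distances that are at most \<open>M\<close> are at most the integer part of \<open>M\<close>.\<close>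
    define D where "D = nat \<lfloor>M\<rfloor>"
    have D: "real D \<le> M" using \<open>0 \<le> M\<close> by (simp add: D_def)
    have leD: "d x y \<le> real D" if xy: "x \<in> S" "y \<in> S" for x y
    proof -
      obtain i where i: "d x y = of_int i" using int[rule_format, OF xy] Ints_cases by blast
      then have "i \<le> \<lfloor>M\<rfloor>" using le[OF xy] by (simp add: le_floor_iff)
      then show ?thesis using i \<open>0 \<le> M\<close> by (simp add: D_def)
    qed
    have "finite S \<and> real (card S) \<le> 200 * real D"
    proof (rule card_le_if_integer_distances[OF _ pq])
      show "body_dist K 0 (x - y) \<in> \<int>" if "x \<in> S" "y \<in> S" for x y
        using int[rule_format, OF that(2,1)] unfolding d_norm .
      show "body_dist K 0 (x - y) \<le> real D" if "x \<in> S" "y \<in> S" for x y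
        using leD[OF that(2,1)] unfolding d_norm .
    qed
    then show "finite S \<and> real (card S) \<le> 200 * M" using D by auto
  qed
qed

end
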